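(* Let $C\subseteq\mathbb{Z}_2^n$ be an $11$-cap of dimension $7$ with a basis $B$ of type $7\text{-}5\text{-}5$. Then $B$ has extended type $7\text{-}5\text{-}5\text{-}(4,4,3)$; that is, if $D=C\setminus B=\{x_1,x_2,x_3\}$ with $|B_{x_1}|=7$ and $|B_{x_2}|=|B_{x_3}|=5$, then $|B_{x_1}\cap B_{x_2}|=|B_{x_1}\cap B_{x_3}|=4$ and $|B_{x_2}\cap B_{x_3}|=3$.
   Context: Work in $\mathbb{Z}_2^n$. An affine combination of a set is a sum of an odd number of its distinct elements; $\operatorname{aff}(S)$ is the set of all affine combinations of elements of $S$, and the dimension of $S$ is the dimension of the affine flat $\operatorname{aff}(S)$. A basis for $S$ is a subset $B\subseteq S$ that is affinely independent (no element is an affine combination of the others) with $\operatorname{aff}(B)=\operatorname{aff}(S)$; its dependent set is $D=S\setminus B$. For $x\in D$, $B_x$ is the unique subset of $B$ whose elements sum to $x$. A quad is a set of four distinct elements summing to $\mathbf{0}$; a cap is a quad-free subset; a $k$-cap is a cap with $k$ elements. The type of $B$ is the list of the numbers $|B_x|$, $x\in D$, in nonincreasing order, separated by hyphens. *)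

theory Defs
  imports "HOL-Analysis.Cartesian_Space" "HOL-Library.Z2" "HOL-Library.Multiset"
begin

definition aff :: "(bit ^ 'n) set \<Rightarrow> (bit ^ 'n) set" where
  "aff S = {\<Sum>T | T. T \<subseteq> S \<and> odd (card T)}"

definition has_dimension :: "(bit ^ 'n) set \<Rightarrow> nat \<Rightarrow> bool" where
  "has_dimension S d \<longleftrightarrow>
     (\<exists>a V. vec.subspace V \<and> vec.dim V = d \<and> aff S = (\<lambda>v. a + v) ` V)"

definition aff_independent :: "(bit ^ 'n) set \<Rightarrow> bool" where
  "aff_independent B \<longleftrightarrow> (\<forall>x\<in>B. x \<notin> aff (B - {x}))"

definition is_basis :: "(bit ^ 'n) set \<Rightarrow> (bit ^ 'n) set \<Rightarrow> bool" where
  "is_basis B S \<longleftrightarrow> B \<subseteq> S \<and> aff_independent B \<and> aff B = aff S"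

text \<open>
  The support \<open>B\<^sub>x\<close>. Only affine combinations count: if the zero vector lies in \<open>aff B\<close>,
  then \<open>x\<close> is also the sum of a subset of \<open>B\<close> of even size, so without the oddness
  condition uniqueness would fail.
\<close>
definition supp :: "(bit ^ 'n) set \<Rightarrow> bit ^ 'n \<Rightarrow> (bit ^ 'n) set" where
  "supp B x = (THE T. T \<subseteq> B \<and> odd (card T) \<and> \<Sum>T = x)"

definition is_quad :: "(bit ^ 'n) set \<Rightarrow> bool" where
  "is_quad Q \<longleftrightarrow> card Q = 4 \<and> \<Sum>Q = 0"

definition is_cap :: "(bit ^ 'n) set \<Rightarrow> bool" where
  "is_cap C \<longleftrightarrow> (\<forall>Q\<subseteq>C. \<not> is_quad Q)"

definition basis_type :: "(bit ^ 'n) set \<Rightarrow> (bit ^ 'n) set \<Rightarrow> nat list" where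
  "basis_type B S =
     rev (sorted_list_of_multiset {#card (supp B x). x \<in># mset_set (S - B)#})"

end

theory Submission imports Defs begin

text \<open>
  Supports turn vector sums into symmetric differences. Since \<open>B\<close> has eight elements, \<open>B\<^sub>x\<^sub>1\<close>
  misses exactly one point \<open>p\<close>. If two supports differ in two points of \<open>B\<close>, the two
  dependent points and these two basis points form a quad; this excludes \<open>B\<^sub>x\<^sub>2 \<subseteq> B\<^sub>x\<^sub>1\<close> and
  \<open>B\<^sub>x\<^sub>3 \<subseteq> B\<^sub>x\<^sub>1\<close>, so both contain \<open>p\<close>, and it excludes \<open>|B\<^sub>x\<^sub>2 \<inter> B\<^sub>x\<^sub>3| = 4\<close>. If
  \<open>|B\<^sub>x\<^sub>2 \<inter> B\<^sub>x\<^sub>3| = 2\<close>, then the symmetric difference of \<open>B\<^sub>x\<^sub>2\<close> and \<open>B\<^sub>x\<^sub>3\<close> is contained in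
  \<open>B\<^sub>x\<^sub>1\<close> and misses only one of its points, which forms a quad with \<open>x\<^sub>1\<close>, \<open>x\<^sub>2\<close>, \<open>x\<^sub>3\<close>.
\<close>

lemma bit_vec_add_self [simp]: "x + x = (0 :: bit ^ 'n)"
  by (simp add: vec_eq_iff)

lemma bit_vec_add_eq_0_iff: "x + y = 0 \<longleftrightarrow> x = (y :: bit ^ 'n)"
  by (metis add.assoc add.right_neutral add.left_neutral bit_vec_add_self)

text \<open>Elements of \<open>S \<inter> T\<close> occur twice on the right and cancel in
  characteristic 2.\<close>

lemma sum_symmetric_difference:
  fixes S T :: "(bit ^ 'n) set"
  assumes "finite S" "finite T"
  shows "\<Sum>((S - T) \<union> (T - S)) = \<Sum>S + \<Sum>T"
proof -
  have S: "\<Sum>S = \<Sum>(S - T) + \<Sum>(S \<inter> T)"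
    using sum.Int_Diff[OF assms(1), of "\<lambda>x. x" T] by (simp add: add.commute)
  have T: "\<Sum>T = \<Sum>(T - S) + \<Sum>(S \<inter> T)"
    using sum.Int_Diff[OF assms(2), of "\<lambda>x. x" S] by (simp add: add.commute Int_commute)
  have "\<Sum>((S - T) \<union> (T - S)) = \<Sum>(S - T) + \<Sum>(T - S)"
    using assms by (intro sum.union_disjoint) auto
  moreover have "\<Sum>S + \<Sum>T = \<Sum>(S - T) + \<Sum>(T - S) + (\<Sum>(S \<inter> T) + \<Sum>(S \<inter> T))"
    unfolding S T by (simp only: ac_simps)
  ultimately show ?thesis by simp
qed

lemma card_symmetric_difference:
  assumes "finite S" "finite T"
  shows "card ((S - T) \<union> (T - S)) + 2 * card (S \<inter> T) = card S + card T"
proof -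
  have "card ((S - T) \<union> (T - S)) = card (S - T) + card (T - S)"
    using assms by (intro card_Un_disjoint) auto
  moreover have "card (S \<inter> T) + card (S - T) = card S"
    using card_Int_Diff[OF assms(1), of T] by simp
  moreover have "card (S \<inter> T) + card (T - S) = card T"
    using card_Int_Diff[OF assms(2), of S] by (simp add: Int_commute)
  ultimately show ?thesis by linarith
qed

text \<open>If an even set summed to zero, each of its elements would equal the sum of the others,
  an odd number of them, and so be an affine combination of them.\<close>

lemma aff_independent_sum_nonzero:
  assumes "aff_independent B" "E \<subseteq> B" "finite E" "E \<noteq> {}" "even (card E)"
  shows "\<Sum>E \<noteq> 0"
proof
  assume "\<Sum>E = 0"
  from assms obtain e where e: "e \<in> E" by auto
  then have "e + \<Sum>(E - {e}) = 0"
    using \<open>\<Sum>E = 0\<close> sum.remove[OF \<open>finite E\<close> e, of "\<lambda>x. x"] by simp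
  then have "\<Sum>(E - {e}) = e" by (simp add: bit_vec_add_eq_0_iff)
  moreover have "odd (card (E - {e}))"
    using assms(3-5) e by (simp add: card_gt_0_iff)
  moreover have "E - {e} \<subseteq> B - {e}" using assms(2) by auto
  ultimately have "e \<in> aff (B - {e})"
    unfolding aff_def by (intro CollectI exI[of _ "E - {e}"]) simp
  then show False using assms(1,2) e unfolding aff_independent_def by auto
qed

text \<open>The symmetric difference of two odd sets is even, and equal sums make it sum to zero; by
  independence it must be empty.\<close>

lemma aff_independent_unique:
  assumes "aff_independent B" "finite B" "S \<subseteq> B" "T \<subseteq> B"
    and "odd (card S)" "odd (card T)" "\<Sum>S = \<Sum>T"
  shows "S = T"
proof (rule ccontr)
  assume "S \<noteq> T"
  have fin: "finite S" "finite T" using assms(2-4) finite_subset by auto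
  let ?E = "(S - T) \<union> (T - S)"
  have "even (card ?E + 2 * card (S \<inter> T))"
    using assms(5,6) by (simp only: card_symmetric_difference[OF fin]) simp
  then have "\<Sum>?E \<noteq> 0"
    using \<open>S \<noteq> T\<close> assms fin by (intro aff_independent_sum_nonzero[OF assms(1)]) auto
  then show False using sum_symmetric_difference[OF fin] assms(7) by simp
qed

text \<open>Justifies the definite description in \<open>supp\<close>: existence comes from
  \<open>aff B = aff C\<close>, uniqueness from independence.\<close>

lemma supp_props:
  assumes "is_basis B C" "finite C" "x \<in> C"
  shows "supp B x \<subseteq> B" "odd (card (supp B x))" "\<Sum>(supp B x) = x"
proof -
  have B: "B \<subseteq> C" "aff_independent B" "aff B = aff C"
    using assms(1) unfolding is_basis_def by auto
  have "finite B" using B assms(2) finite_subset by auto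
  have "x \<in> aff C" unfolding aff_def using assms(3) by (auto intro!: exI[of _ "{x}"])
  then have "x \<in> aff B" using B(3) by simp
  then obtain T where "T \<subseteq> B \<and> odd (card T) \<and> \<Sum>T = x"
    unfolding aff_def by auto
  then have "\<exists>!T. T \<subseteq> B \<and> odd (card T) \<and> \<Sum>T = x"
    using aff_independent_unique[OF B(2) \<open>finite B\<close>] by (metis (no_types, lifting))
  from theI'[OF this] show "supp B x \<subseteq> B" "odd (card (supp B x))" "\<Sum>(supp B x) = x"
    unfolding supp_def by auto
qed

lemma is_cap_sum_nonzero:
  assumes "is_cap C" "{a, b, c, d} \<subseteq> C" "distinct [a, b, c, d]"
  shows "a + b + c + d \<noteq> 0"
proof -
  have "\<not> is_quad {a, b, c, d}" using assms(1,2) unfolding is_cap_def by blast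
  then show ?thesis using assms(3) unfolding is_quad_def by (auto simp: add.assoc)
qed

lemma card_symmetric_difference_supp_ne_2:
  assumes "is_cap C" "is_basis B C" "finite C" "x \<in> C - B" "y \<in> C - B" "x \<noteq> y"
  shows "card ((supp B x - supp B y) \<union> (supp B y - supp B x)) \<noteq> 2"
proof
  let ?E = "(supp B x - supp B y) \<union> (supp B y - supp B x)"
  assume "card ?E = 2"
  then obtain a b where ab: "?E = {a, b}" "a \<noteq> b" by (auto simp: card_2_iff)
  have sx: "supp B x \<subseteq> B" "\<Sum>(supp B x) = x" and sy: "supp B y \<subseteq> B" "\<Sum>(supp B y) = y"
    using supp_props[OF assms(2,3)] assms(4,5) by auto
  have "B \<subseteq> C" using assms(2) unfolding is_basis_def by auto
  then have "finite (supp B x)" "finite (supp B y)"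
    using sx sy assms(3) by (meson finite_subset)+
  from sum_symmetric_difference[OF this] have "a + b = x + y"
    using ab sx sy by simp
  then have "x + y + a + b = 0" by (metis add.assoc bit_vec_add_self)
  moreover have "{a, b} \<subseteq> B" using ab(1) sx sy by blast
  ultimately show False
    using is_cap_sum_nonzero[of C x y a b] assms ab(2) \<open>B \<subseteq> C\<close> by auto
qed

theorem theorem6p1:
  fixes C B :: "(bit ^ 'n) set"
  assumes "is_cap C"
    and "card C = 11"
    and "has_dimension C 7"
    and "is_basis B C"
    and "basis_type B C = [7, 5, 5]"
  shows "\<forall>x1 x2 x3.
    C - B = {x1, x2, x3} \<and>
    card (supp B x1) = 7 \<and> card (supp B x2) = 5 \<and> card (supp B x3) = 5 \<longrightarrow>
    card (supp B x1 \<inter> supp B x2) = 4 \<and>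
    card (supp B x1 \<inter> supp B x3) = 4 \<and>
    card (supp B x2 \<inter> supp B x3) = 3"
proof (intro allI impI, elim conjE)
  fix x1 x2 x3
  assume D: "C - B = {x1, x2, x3}"
    and c1: "card (supp B x1) = 7" and c2: "card (supp B x2) = 5" and c3: "card (supp B x3) = 5"
  have finC: "finite C" using assms(2) card.infinite by fastforce
  have BC: "B \<subseteq> C" using assms(4) unfolding is_basis_def by auto
  have finB: "finite B" using BC finC finite_subset by auto
  \<comment> \<open>The length of the type counts the dependent points: there are three, so
    \<open>B\<close> has 11 - 3 = 8 elements and the \<open>x\<close>s are distinct.\<close>
  have "mset (basis_type B C) = {#card (supp B x). x \<in># mset_set (C - B)#}"
    unfolding basis_type_def by simp
  from arg_cong[OF this, of size] have cD: "card (C - B) = 3" using assms(5) by simp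
  have cB: "card B = 8"
    using cD card_Diff_subset[OF finB BC] card_mono[OF finC BC] assms(2) by simp
  have ne: "x1 \<noteq> x2" "x1 \<noteq> x3" "x2 \<noteq> x3"
    using cD D by (auto simp: card_insert_if split: if_splits)
  have xC: "x1 \<in> C - B" "x2 \<in> C - B" "x3 \<in> C - B" using D by auto
  define S1 S2 S3 where S: "S1 = supp B x1" "S2 = supp B x2" "S3 = supp B x3"
  have sub: "S1 \<subseteq> B" "S2 \<subseteq> B" "S3 \<subseteq> B"
    and sum: "\<Sum>S1 = x1" "\<Sum>S2 = x2" "\<Sum>S3 = x3"
    using supp_props[OF assms(4) finC] xC unfolding S by auto
  have fin: "finite S1" "finite S2" "finite S3" using sub finB by (meson finite_subset)+
  have union: "card (X \<union> Y) \<le> 8" if "X \<subseteq> B" "Y \<subseteq> B" for X Y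
    using card_mono[OF finB, of "X \<union> Y"] that cB by simp
  \<comment> \<open>Stated for a generic support of size 5, to serve both \<open>S2\<close> and
    \<open>S3\<close>.\<close>
  have card4: "card (S1 \<inter> T) = 4"
    if T: "T = supp B y" "T \<subseteq> B" "card T = 5" and y: "y \<in> C - B" "x1 \<noteq> y" for T y
  proof -
    have finT: "finite T" using T(2) finB finite_subset by auto
    \<comment> \<open>Otherwise the symmetric difference would have 7 + 5 - 10 = 2 elements.\<close>
    have "card (S1 \<inter> T) \<noteq> 5"
      using card_symmetric_difference_supp_ne_2[OF assms(1,4) finC xC(1) y]
        card_symmetric_difference[OF fin(1) finT] c1 T(3) unfolding S T(1) by simp
    moreover have "card (S1 \<inter> T) \<le> 5" using card_mono[OF finT, of "S1 \<inter> T"] T(3) by simp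
    \<comment> \<open>Two subsets of an 8-element set with 7 and 5 elements share at least 7 + 5 -
      8.\<close>
    moreover have "card (S1 \<inter> T) \<ge> 4"
      using card_Un_Int[OF fin(1) finT] union[OF sub(1) T(2)] c1 T(3) S by simp
    ultimately show ?thesis by linarith
  qed
  have k12: "card (S1 \<inter> S2) = 4" and k13: "card (S1 \<inter> S3) = 4"
    using card4[OF S(2) sub(2) _ xC(2) ne(1)] card4[OF S(3) sub(3) _ xC(3) ne(2)] c2 c3 S by auto
  have "card (S2 \<inter> S3) \<noteq> 4"
    using card_symmetric_difference_supp_ne_2[OF assms(1,4) finC xC(2,3) ne(3)]
      card_symmetric_difference[OF fin(2,3)] c2 c3 unfolding S by simp
  moreover have "card (S2 \<inter> S3) \<noteq> 5"
  proof
    \<comment> \<open>The supports would coincide, and hence so would their sums \<open>x2\<close>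
      and \<open>x3\<close>.\<close>
    assume k: "card (S2 \<inter> S3) = 5"
    have "S2 \<inter> S3 = S2" "S2 \<inter> S3 = S3"
      using k c2 c3 fin unfolding S by (simp_all add: card_subset_eq)
    then show False using sum ne by simp
  qed
  moreover have "card (S2 \<inter> S3) \<le> 5" using card_mono[OF fin(2), of "S2 \<inter> S3"] c2 S by simp
  moreover have "card (S2 \<inter> S3) \<ge> 2"
    using card_Un_Int[OF fin(2,3)] union[OF sub(2,3)] c2 c3 S by simp
  moreover have "card (S2 \<inter> S3) \<noteq> 2"
  proof
    assume k: "card (S2 \<inter> S3) = 2"
    have "card (B - S1) = 1" using card_Diff_subset[OF fin(1) sub(1)] cB c1 S by simp
    then obtain p where p: "B - S1 = {p}" by (auto simp: card_1_singleton_iff)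
    \<comment> \<open>An inclusion would make the intersection have 5 elements instead of 4.\<close>
    have "\<not> S2 \<subseteq> S1" "\<not> S3 \<subseteq> S1"
      using k12 k13 c2 c3 S by (auto simp: Int_absorb1)
    then have p23: "p \<in> S2" "p \<in> S3" using p sub by auto
    let ?E = "(S2 - S3) \<union> (S3 - S2)"
    have E1: "?E \<subseteq> S1"
    proof
      fix z assume "z \<in> ?E"
      then have "z \<in> B" "z \<noteq> p" using sub p23 by auto
      then show "z \<in> S1" using p by blast
    qed
    have finE: "finite ?E" using fin by auto
    \<comment> \<open>5 + 5 - 2 * 2 = 6, one less than the size of \<open>S1\<close>.\<close>
    have "card ?E = 6" using card_symmetric_difference[OF fin(2,3)] k c2 c3 S by simp
    then have "card (S1 - ?E) = 1" using card_Diff_subset[OF finE E1] c1 S by simp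
    then obtain b where b: "S1 - ?E = {b}" by (auto simp: card_1_singleton_iff)
    have "x1 = \<Sum>(S1 - ?E) + \<Sum>?E"
      using sum.subset_diff[OF E1 fin(1), of "\<lambda>x. x"] sum by simp
    then have "x1 = b + (x2 + x3)"
      using sum_symmetric_difference[OF fin(2,3)] sum b by simp
    then have "x1 + (b + (x2 + x3)) = 0" using bit_vec_add_eq_0_iff by blast
    then have "x1 + x2 + x3 + b = 0" by (simp add: ac_simps)
    \<comment> \<open>This makes \<open>b\<close> differ from the three dependent points, so the
      four points are distinct.\<close>
    moreover have "b \<in> B" using b sub by auto
    ultimately show False
      using is_cap_sum_nonzero[OF assms(1), of x1 x2 x3 b] xC BC ne by auto
  qed
  ultimately have "card (S2 \<inter> S3) = 3" by linarith
  then show "card (supp B x1 \<inter> supp B x2) = 4 \<and> card (supp B x1 \<inter> supp B x3) = 4 \<and>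
    card (supp B x2 \<inter> supp B x3) = 3"
    using k12 k13 S by simp
qed

end
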